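(* Let $S=\{4,5,7,12,23,229,562\}$. Suppose that for every positive integer $n$ with $n\notin S$, the number $n!+1$ is square-free. Then the only solutions to the equation $n!+1=m^2$ in pairs of positive integers $(n,m)$ are $(4,5)$, $(5,11)$, and $(7,71)$.
   Context: A positive integer $k$ is square-free if and only if no perfect square other than $1$ divides $k$. *)

theory Defs
  imports "HOL-Computational_Algebra.Squarefree"
begin

end

theory Submission
  imports Defs
begin

text \<open>
  If \<open>n! + 1 = m\<^sup>2\<close> and \<open>n! + 1\<close> is squarefree, then \<open>m\<close> is a unit, so \<open>n! + 1 = 1\<close>,
  which is absurd. Hence only the seven exceptional values of \<open>n\<close> can occur in a solution.
  For \<open>4\<close>, \<open>5\<close> and \<open>7\<close> the number \<open>n! + 1\<close> is \<open>25\<close>, \<open>121\<close> and \<open>5041\<close>, each the square of the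
  stated \<open>m\<close>. For \<open>12\<close>, \<open>23\<close>, \<open>229\<close> and \<open>562\<close> it is a quadratic nonresidue modulo the primes
  \<open>29\<close>, \<open>59\<close>, \<open>233\<close> and \<open>569\<close> respectively. A witnessing prime has to exceed \<open>n\<close>, since
  \<open>n! + 1\<close> is congruent to \<open>1\<close> modulo every prime up to \<open>n\<close>; these are the least that work.
\<close>

lemma squarefree_power2_iff_nat: "squarefree (m\<^sup>2) \<longleftrightarrow> m = 1" for m :: nat
  by (auto simp: squarefree_def)

text \<open>
  Reducing after every factor keeps the numbers small, so that the residue of a large
  factorial can be computed by rewriting. The integers are used because their numerals, unlike
  the unary naturals, are binary when code equations are unfolded.
\<close>

lemma fact_mod_eq_fold:
  "int (fact n) mod q = fold (\<lambda>k a. k * a mod q) [1..int n] (1 mod q)"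
proof (induction n)
  case (Suc n)
  have "[1..int (Suc n)] = [1..int n] @ [int (Suc n)]"
    using upto_rec2[of 1 "int (Suc n)"] by simp
  then have "fold (\<lambda>k a. k * a mod q) [1..int (Suc n)] (1 mod q) =
      int (Suc n) * (int (fact n) mod q) mod q"
    using Suc by simp
  also have "\<dots> = int (fact (Suc n)) mod q"
    by (simp only: mod_mult_right_eq fact_Suc of_nat_mult of_nat_id)
  finally show ?case
    by simp
qed simp

text \<open>
  Every residue is congruent to some \<open>\<plusminus>k\<close> with \<open>0 \<le> k \<le> q div 2\<close>, so the squares of these \<open>k\<close>
  exhaust the squares modulo \<open>q\<close>. As a list, they turn the nonresidue condition into a computation.
\<close>

lemma not_power2_if_nonresidue:
  fixes N q m :: int
  assumes "q > 0" "list_all (\<lambda>k. k * k mod q \<noteq> N mod q) [0..q div 2]"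
  shows "N \<noteq> m\<^sup>2"
proof
  assume "N = m\<^sup>2"
  define r where "r = m mod q"
  define k where "k = min r (q - r)"
  have "0 \<le> r" "r < q"
    using assms(1) by (simp_all add: r_def)
  then have "k \<in> set [0..q div 2]"
    by (auto simp: k_def min_def)
  moreover have "k * k mod q = N mod q"
  proof -
    have "k * k mod q = r * r mod q"
    proof (cases "k = r")
      case False
      then have "k * k = r * r + q * (q - 2 * r)"
        by (simp add: k_def min_def algebra_simps split: if_splits)
      then show ?thesis
        by simp
    qed simp
    also have "\<dots> = N mod q"
      by (simp add: r_def \<open>N = m\<^sup>2\<close> power2_eq_square mod_mult_eq)
    finally show ?thesis .
  qed
  ultimately show False
    using assms(2) by (auto simp: list_all_iff)
qed

lemma fact_plus_1_not_power2:
  fixes n m :: nat and q r :: int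
  assumes "q > 0" "fold (\<lambda>k a. k * a mod q) [1..int n] (1 mod q) = r"
    and "list_all (\<lambda>k. k * k mod q \<noteq> (r + 1) mod q) [0..q div 2]"
  shows "fact n + 1 \<noteq> m\<^sup>2"
proof
  assume eq: "fact n + 1 = m\<^sup>2"
  have "r = int (fact n) mod q"
    using assms(2) by (simp only: fact_mod_eq_fold)
  then have "(r + 1) mod q = (int (fact n) + 1) mod q"
    by (simp only: mod_add_left_eq)
  then have "int (fact n) + 1 \<noteq> (int m)\<^sup>2"
    using not_power2_if_nonresidue assms(1,3) by metis
  moreover have "int (fact n) + 1 = (int m)\<^sup>2"
    using arg_cong[OF eq, of int] by (simp only: of_nat_add of_nat_1 of_nat_power)
  ultimately show False
    by contradiction
qed

lemma fact_12_plus_1_not_power2: "fact 12 + 1 \<noteq> m\<^sup>2" for m :: nat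
proof (rule fact_plus_1_not_power2)
  have "fold (\<lambda>k a. k * a mod 29) [1..12] (1 mod 29) = (16 :: int)"
    by code_simp
  then show "fold (\<lambda>k a. k * a mod 29) [1..int 12] (1 mod 29) = (16 :: int)"
    by (simp only: of_nat_numeral)
  show "list_all (\<lambda>k::int. k * k mod 29 \<noteq> (16 + 1) mod 29) [0..29 div 2]"
    by code_simp
qed simp

lemma fact_23_plus_1_not_power2: "fact 23 + 1 \<noteq> m\<^sup>2" for m :: nat
proof (rule fact_plus_1_not_power2)
  have "fold (\<lambda>k a. k * a mod 59) [1..23] (1 mod 59) = (38 :: int)"
    by code_simp
  then show "fold (\<lambda>k a. k * a mod 59) [1..int 23] (1 mod 59) = (38 :: int)"
    by (simp only: of_nat_numeral)
  show "list_all (\<lambda>k::int. k * k mod 59 \<noteq> (38 + 1) mod 59) [0..59 div 2]"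
    by code_simp
qed simp

lemma fact_229_plus_1_not_power2: "fact 229 + 1 \<noteq> m\<^sup>2" for m :: nat
proof (rule fact_plus_1_not_power2)
  have "fold (\<lambda>k a. k * a mod 233) [1..229] (1 mod 233) = (39 :: int)"
    by code_simp
  then show "fold (\<lambda>k a. k * a mod 233) [1..int 229] (1 mod 233) = (39 :: int)"
    by (simp only: of_nat_numeral)
  show "list_all (\<lambda>k::int. k * k mod 233 \<noteq> (39 + 1) mod 233) [0..233 div 2]"
    by code_simp
qed simp

lemma fact_562_plus_1_not_power2: "fact 562 + 1 \<noteq> m\<^sup>2" for m :: nat
proof (rule fact_plus_1_not_power2)
  have "fold (\<lambda>k a. k * a mod 569) [1..562] (1 mod 569) = (260 :: int)"
    by code_simp
  then show "fold (\<lambda>k a. k * a mod 569) [1..int 562] (1 mod 569) = (260 :: int)"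
    by (simp only: of_nat_numeral)
  show "list_all (\<lambda>k::int. k * k mod 569 \<noteq> (260 + 1) mod 569) [0..569 div 2]"
    by code_simp
qed simp

theorem corollary4p1:
  fixes S :: "nat set"
  defines "S \<equiv> {4, 5, 7, 12, 23, 229, 562}"
  assumes "\<And>n :: nat. n > 0 \<Longrightarrow> n \<notin> S \<Longrightarrow> squarefree (fact n + 1 :: nat)"
  shows "{(n :: nat, m :: nat). n > 0 \<and> m > 0 \<and> fact n + 1 = m ^ 2} = {(4, 5), (5, 11), (7, 71)}"
proof -
  have "(n, m) \<in> {(4, 5), (5, 11), (7, 71)}" if n: "n > 0" and eq: "fact n + 1 = m\<^sup>2" for n m :: nat
  proof -
    have "n \<in> S"
    proof (rule ccontr)
      assume "n \<notin> S"
      with assms(2) n have "squarefree (fact n + 1 :: nat)"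
        by blast
      with eq have "m = 1"
        by (simp only: squarefree_power2_iff_nat)
      with eq show False
        by simp
    qed
    then have "n = 4 \<or> n = 5 \<or> n = 7"
      using eq fact_12_plus_1_not_power2 fact_23_plus_1_not_power2
        fact_229_plus_1_not_power2 fact_562_plus_1_not_power2
      unfolding S_def by blast
    moreover have "m = 5" if "n = 4"
    proof -
      have "m\<^sup>2 = 5\<^sup>2"
        using eq that by (simp add: fact_numeral)
      then show ?thesis
        by (rule power2_eq_imp_eq) simp_all
    qed
    moreover have "m = 11" if "n = 5"
    proof -
      have "m\<^sup>2 = 11\<^sup>2"
        using eq that by (simp add: fact_numeral)
      then show ?thesis
        by (rule power2_eq_imp_eq) simp_all
    qed
    moreover have "m = 71" if "n = 7"
    proof -
      have "m\<^sup>2 = 71\<^sup>2"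
        using eq that by (simp add: fact_numeral)
      then show ?thesis
        by (rule power2_eq_imp_eq) simp_all
    qed
    ultimately show ?thesis
      by blast
  qed
  then show ?thesis
    by (auto simp: fact_numeral)
qed

end
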